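(* Let $\kappa>\omega$ and let $U,W$ be $\kappa$-complete ultrafilters over $\kappa$. Let $\mu\leq\lambda$ be cardinals. Suppose that $U$ is $(\lambda,\lambda)$-cohesive and $W$ is $(\lambda,\mu)$-cohesive, or that $W$ is $(\lambda,\lambda)$-cohesive and $U$ is $(\lambda,\mu)$-cohesive. Then the Fubini product $U\cdot W$ is $(\lambda,\mu)$-cohesive.
   Context: An ultrafilter $D$ is $(\lambda,\mu)$-cohesive if for every $\mathcal{A}\in[D]^\lambda$ there is $\mathcal{B}\in[\mathcal{A}]^\mu$ with $\bigcap\mathcal{B}\in D$. The Fubini product $U\cdot W$ is the ultrafilter on $\kappa\times\kappa$ given by $X\in U\cdot W$ iff $\{\alpha<\kappa\mid \{\beta<\kappa\mid (\alpha,\beta)\in X\}\in W\}\in U$. *)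

theory Defs
  imports Main
begin

unbundle cardinal_syntax

text \<open>
  A cardinal is a relation \<open>\<kappa>\<close> with \<open>Card_order \<kappa>\<close>, whose points are the elements of
  \<open>Field \<kappa>\<close>; an ultrafilter over \<open>\<kappa>\<close> is an ultrafilter over the set \<open>Field \<kappa>\<close>.
  Ultrafilters are allowed to be principal.
\<close>

definition ultrafilter_over :: "'a set \<Rightarrow> 'a set set \<Rightarrow> bool" where
  "ultrafilter_over S D \<longleftrightarrow>
     D \<subseteq> Pow S \<and> S \<in> D \<and> {} \<notin> D \<and>
     (\<forall>X\<in>D. \<forall>Y. X \<subseteq> Y \<and> Y \<subseteq> S \<longrightarrow> Y \<in> D) \<and>
     (\<forall>X\<in>D. \<forall>Y\<in>D. X \<inter> Y \<in> D) \<and>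
     (\<forall>X. X \<subseteq> S \<longrightarrow> X \<in> D \<or> S - X \<in> D)"

text \<open>
  Intersections are taken relative to the underlying set \<open>S\<close>; this matters only for the
  empty family, whose intersection is \<open>S\<close> rather than \<open>UNIV\<close>.
\<close>

definition complete_over :: "'k rel \<Rightarrow> 'a set \<Rightarrow> 'a set set \<Rightarrow> bool" where
  "complete_over \<kappa> S D \<longleftrightarrow> (\<forall>\<B>. \<B> \<subseteq> D \<and> |\<B>| <o \<kappa> \<longrightarrow> S \<inter> \<Inter>\<B> \<in> D)"

definition cohesive :: "'l rel \<Rightarrow> 'm rel \<Rightarrow> 'a set \<Rightarrow> 'a set set \<Rightarrow> bool" where
  "cohesive lam \<mu> S D \<longleftrightarrow>
     (\<forall>\<A>. \<A> \<subseteq> D \<and> |\<A>| =o lam \<longrightarrow> (\<exists>\<B>. \<B> \<subseteq> \<A> \<and> |\<B>| =o \<mu> \<and> S \<inter> \<Inter>\<B> \<in> D))"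

definition Fubini_product ::
  "'a set \<Rightarrow> 'b set \<Rightarrow> 'a set set \<Rightarrow> 'b set set \<Rightarrow> ('a \<times> 'b) set set" where
  "Fubini_product S T U W =
     {X. X \<subseteq> S \<times> T \<and> {\<alpha>\<in>S. {\<beta>\<in>T. (\<alpha>, \<beta>) \<in> X} \<in> W} \<in> U}"

lemma ultrafilter_over_Fubini_product:
  assumes U: "ultrafilter_over S U" and W: "ultrafilter_over T W"
  shows "ultrafilter_over (S \<times> T) (Fubini_product S T U W)"
proof -
  define sec where "sec X \<alpha> = {\<beta>\<in>T. (\<alpha>, \<beta>) \<in> X}" for X :: "('a \<times> 'b) set" and \<alpha>
  define big where "big X = {\<alpha>\<in>S. sec X \<alpha> \<in> W}" for X
  have F: "X \<in> Fubini_product S T U W \<longleftrightarrow> X \<subseteq> S \<times> T \<and> big X \<in> U" for X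
    by (simp add: Fubini_product_def big_def sec_def)
  have U_up: "Y \<in> U" if "X \<in> U" "X \<subseteq> Y" "Y \<subseteq> S" for X Y
    using U that unfolding ultrafilter_over_def by blast
  have W_up: "Y \<in> W" if "X \<in> W" "X \<subseteq> Y" "Y \<subseteq> T" for X Y
    using W that unfolding ultrafilter_over_def by blast
  have U_int: "X \<inter> Y \<in> U" if "X \<in> U" "Y \<in> U" for X Y
    using U that unfolding ultrafilter_over_def by blast
  have W_int: "X \<inter> Y \<in> W" if "X \<in> W" "Y \<in> W" for X Y
    using W that unfolding ultrafilter_over_def by blast
  have top: "S \<times> T \<in> Fubini_product S T U W"
  proof -
    have "sec (S \<times> T) \<alpha> = T" if "\<alpha> \<in> S" for \<alpha>
      using that by (auto simp: sec_def)
    then have "big (S \<times> T) = S"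
      using W by (auto simp: big_def ultrafilter_over_def)
    then show ?thesis using U by (simp add: F ultrafilter_over_def)
  qed
  have bot: "{} \<notin> Fubini_product S T U W"
    using U W by (simp add: F big_def sec_def ultrafilter_over_def)
  have up: "Y \<in> Fubini_product S T U W"
    if "X \<in> Fubini_product S T U W" "X \<subseteq> Y" "Y \<subseteq> S \<times> T" for X Y
  proof -
    have "big X \<subseteq> big Y"
      using that(2) by (auto simp: big_def sec_def intro: W_up[unfolded sec_def])
    moreover have "big Y \<subseteq> S" by (auto simp: big_def)
    ultimately show ?thesis using that U_up unfolding F by blast
  qed
  have inter: "X \<inter> Y \<in> Fubini_product S T U W"
    if "X \<in> Fubini_product S T U W" "Y \<in> Fubini_product S T U W" for X Y
  proof -
    have "sec (X \<inter> Y) \<alpha> = sec X \<alpha> \<inter> sec Y \<alpha>" for \<alpha> by (auto simp: sec_def)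
    then have "big X \<inter> big Y \<subseteq> big (X \<inter> Y)"
      using W_int by (auto simp: big_def)
    moreover have "big (X \<inter> Y) \<subseteq> S" by (auto simp: big_def)
    ultimately have "big (X \<inter> Y) \<in> U"
      using that U_int U_up unfolding F by meson
    then show ?thesis using that unfolding F by blast
  qed
  have compl: "X \<in> Fubini_product S T U W \<or> S \<times> T - X \<in> Fubini_product S T U W"
    if X: "X \<subseteq> S \<times> T" for X
  proof (cases "big X \<in> U")
    case True
    then show ?thesis using X F by blast
  next
    case False
    have "big X \<subseteq> S" by (auto simp: big_def)
    then have "S - big X \<in> U"
      using False U unfolding ultrafilter_over_def by blast
    moreover have "S - big X \<subseteq> big (S \<times> T - X)"
    proof
      fix \<alpha> assume a: "\<alpha> \<in> S - big X"
      have "sec X \<alpha> \<subseteq> T" by (auto simp: sec_def)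
      then have "T - sec X \<alpha> \<in> W"
        using a W unfolding big_def ultrafilter_over_def by blast
      moreover have "T - sec X \<alpha> = sec (S \<times> T - X) \<alpha>"
        using a by (auto simp: sec_def)
      ultimately show "\<alpha> \<in> big (S \<times> T - X)" using a by (simp add: big_def)
    qed
    moreover have "big (S \<times> T - X) \<subseteq> S" by (auto simp: big_def)
    ultimately have "big (S \<times> T - X) \<in> U" using U_up by blast
    then show ?thesis unfolding F by blast
  qed
  show ?thesis
    unfolding ultrafilter_over_def
    using top bot up inter compl by (auto simp: F)
qed

end

theory Submission
  imports Defs
begin

text \<open>
  If \<open>W\<close> is nonprincipal, let \<open>\<pi>\<close> be minimal modulo \<open>W\<close> among the functions that are unbounded modulo \<open>W\<close>. By
  minimality, the modified diagonal intersection \<open>{\<beta>. \<forall>\<alpha> < \<pi> \<beta>. \<beta> \<in> f \<alpha>}\<close> of a family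
  \<open>f : \<kappa> \<rightarrow> W\<close> belongs to \<open>W\<close>, and it is contained in every \<open>f \<alpha>\<close> up to the set
  \<open>{\<beta>. \<pi> \<beta> \<le> \<alpha>}\<close>, which is not in \<open>W\<close> and does not depend on \<open>f\<close>. So each
  \<open>X \<in> U \<cdot> W\<close> is represented by a single pair in \<open>U \<times> W\<close>, namely the set of \<open>\<alpha>\<close> whose
  section is in \<open>W\<close> and the diagonal intersection of those sections. Applying the two cohesiveness
  hypotheses successively to these components, in either order, thins out a family of size \<open>\<lambda>\<close>
  first to size \<open>\<lambda>\<close> and then to size \<open>\<mu>\<close>.

  Different \<open>X\<close> may have the same component, and when \<open>\<lambda>\<close> is singular one cannot pass to a
  constant subfamily of size \<open>\<lambda>\<close>. Instead the components are made distinct by coding \<open>X\<close>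
  into a set that is null for the ultrafilter.
\<close>

section \<open>Closure properties of ultrafilters and completeness for indexed families\<close>

lemma ultrafilter_over_subset: "ultrafilter_over S D \<Longrightarrow> X \<in> D \<Longrightarrow> X \<subseteq> S"
  unfolding ultrafilter_over_def by blast

lemma ultrafilter_over_top: "ultrafilter_over S D \<Longrightarrow> S \<in> D"
  unfolding ultrafilter_over_def by blast

lemma ultrafilter_over_nonempty: "ultrafilter_over S D \<Longrightarrow> X \<in> D \<Longrightarrow> \<exists>x. x \<in> X"
  unfolding ultrafilter_over_def by (metis equals0I)

lemma ultrafilter_over_mono:
  "ultrafilter_over S D \<Longrightarrow> X \<in> D \<Longrightarrow> X \<subseteq> Y \<Longrightarrow> Y \<subseteq> S \<Longrightarrow> Y \<in> D"
  unfolding ultrafilter_over_def by blast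

lemma ultrafilter_over_Int:
  "ultrafilter_over S D \<Longrightarrow> X \<in> D \<Longrightarrow> Y \<in> D \<Longrightarrow> X \<inter> Y \<in> D"
  unfolding ultrafilter_over_def by blast

lemma ultrafilter_over_compl:
  "ultrafilter_over S D \<Longrightarrow> X \<subseteq> S \<Longrightarrow> X \<notin> D \<Longrightarrow> S - X \<in> D"
  unfolding ultrafilter_over_def by blast

lemma complete_over_INT:
  assumes "complete_over \<kappa> S D" and "|I| <o \<kappa>" and "\<And>i. i \<in> I \<Longrightarrow> f i \<in> D"
  shows "S \<inter> (\<Inter>i\<in>I. f i) \<in> D"
proof -
  have "|f ` I| <o \<kappa>"
    using card_of_image assms(2) by (rule ordLeq_ordLess_trans)
  then show ?thesis
    using assms(1,3) unfolding complete_over_def by blast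
qed

section \<open>Cohesiveness for families with repetitions\<close>

lemma infinite_split_ultrafilter:
  assumes inf: "infinite S" and U: "ultrafilter_over S U"
  obtains C h where "C \<in> U" "inj_on h S" "h ` S \<subseteq> S - C"
proof -
  \<comment> \<open>Split \<open>S\<close> into two copies of itself; one half lies in
    \<open>U\<close> and becomes \<open>C\<close>, or its complement does. The other half is null
    and holds a full copy of \<open>S\<close>.\<close>
  have "|S <+> S| =o |S|"
    by (rule card_of_Plus_infinite1[OF inf card_of_refl[THEN ordIso_imp_ordLeq]])
  then obtain h where h: "bij_betw h (S <+> S) S"
    using card_of_ordIso by blast
  define A where "A = h ` Inl ` S"
  define B where "B = h ` Inr ` S"
  have inj: "inj_on h (S <+> S)" and im: "h ` (S <+> S) = S"
    using h by (auto simp: bij_betw_def)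
  have AB: "A \<union> B = S"
    using im by (simp add: A_def B_def Plus_def image_Un)
  have disj: "A \<inter> B = {}"
    using inj by (auto simp: A_def B_def inj_on_def)
  have inl: "inj_on (h \<circ> Inl) S" and inr: "inj_on (h \<circ> Inr) S"
    using inj by (auto simp: inj_on_def)
  show thesis
  proof (cases "A \<in> U")
    case True
    have "(h \<circ> Inr) ` S \<subseteq> S - A"
      using AB disj by (auto simp: B_def)
    with that True inr show ?thesis by blast
  next
    case False
    then have "S - A \<in> U"
      using ultrafilter_over_compl[OF U] AB by blast
    moreover have "(h \<circ> Inl) ` S \<subseteq> S - (S - A)"
      using AB by (auto simp: A_def)
    ultimately show ?thesis using that inl by blast
  qed
qed

text \<open>The image of \<open>f\<close> may be smaller than \<open>lam\<close>, so
  \<open>cohesive\<close> is applied to an injective perturbation of \<open>f\<close>. The bound by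
  \<open>|Pow S|\<close> supplies a distinct code for every index.\<close>

lemma cohesive_indexed:
  assumes inf: "infinite S" and U: "ultrafilter_over S U" and coh: "cohesive lam \<mu> S U"
    and I: "|I| =o lam" and le: "|I| \<le>o |Pow S|" and f: "\<And>i. i \<in> I \<Longrightarrow> f i \<in> U"
  obtains J where "J \<subseteq> I" "|J| =o \<mu>" "S \<inter> (\<Inter>i\<in>J. f i) \<in> U"
proof -
  obtain C h where C: "C \<in> U" and h: "inj_on h S" "h ` S \<subseteq> S - C"
    using infinite_split_ultrafilter[OF inf U] .
  obtain e where e: "inj_on e I" "e ` I \<subseteq> Pow S"
    using le card_of_ordLeq[of I "Pow S"] by blast
  \<comment> \<open>The code \<open>e i\<close> is copied by \<open>h\<close> into the null set
    \<open>S - C\<close>, where it cannot affect membership in \<open>U\<close>.\<close>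
  define g where "g i = (f i \<inter> C) \<union> h ` e i" for i
  have CS: "C \<subseteq> S" using ultrafilter_over_subset[OF U C] .
  have he: "h ` e i \<subseteq> S - C" if "i \<in> I" for i
    using e(2) h(2) that by blast
  have gU: "g i \<in> U" if "i \<in> I" for i
    by (rule ultrafilter_over_mono[OF U ultrafilter_over_Int[OF U f[OF that] C]])
      (use he[OF that] CS in \<open>auto simp: g_def\<close>)
  have ginj: "inj_on g I"
  proof (rule inj_onI)
    fix i j assume ij: "i \<in> I" "j \<in> I" "g i = g j"
    have "g k - C = h ` e k" if "k \<in> I" for k
      using he[OF that] by (auto simp: g_def)
    then have "h ` e i = h ` e j" using ij by metis
    then have "e i = e j"
      using inj_on_image_eq_iff[OF h(1)] e(2) ij by (meson PowD image_subset_iff)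
    then show "i = j" using e(1) ij by (auto dest: inj_onD)
  qed
  have "|g ` I| =o |I|"
    using ginj by (metis card_of_ordIsoI inj_on_imp_bij_betw ordIso_symmetric)
  then have "|g ` I| =o lam" using I by (rule ordIso_transitive)
  then obtain \<B> where B: "\<B> \<subseteq> g ` I" "|\<B>| =o \<mu>" "S \<inter> \<Inter>\<B> \<in> U"
    using coh gU unfolding cohesive_def by (metis image_subsetI)
  obtain J where J: "J \<subseteq> I" "\<B> = g ` J"
    using B(1) by (auto simp: subset_image_iff)
  have "bij_betw g J \<B>"
    using ginj J by (auto simp: bij_betw_def intro: inj_on_subset)
  then have "|J| =o \<mu>"
    using B(2) by (meson card_of_ordIsoI ordIso_transitive)
  \<comment> \<open>Intersecting with \<open>C\<close> erases the codes, and on \<open>C\<close>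
    each \<open>g i\<close> lies in \<open>f i\<close>.\<close>
  moreover have "S \<inter> (\<Inter>i\<in>J. f i) \<in> U"
  proof (rule ultrafilter_over_mono[OF U ultrafilter_over_Int[OF U B(3) C]])
    show "S \<inter> \<Inter>\<B> \<inter> C \<subseteq> S \<inter> (\<Inter>i\<in>J. f i)"
    proof -
      have "x \<in> f i" if "x \<in> g i" "x \<in> C" "i \<in> J" for x i
        using that he[of i] J(1) by (auto simp: g_def)
      then show ?thesis by (auto simp: J(2))
    qed
  qed simp
  ultimately show thesis using that J(1) by blast
qed

section \<open>Functions modulo the ultrafilter and diagonal intersections\<close>

lemma card_of_under_less:
  assumes "Card_order \<kappa>" and "infinite (Field \<kappa>)" and "a \<in> Field \<kappa>"
  shows "|under \<kappa> a| <o \<kappa>"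
proof -
  obtain b where b: "b \<in> Field \<kappa>" "a \<noteq> b" "(a, b) \<in> \<kappa>"
    using infinite_Card_order_limit[OF assms] by blast
  have "trans \<kappa>" "antisym \<kappa>"
    using assms(1) by (simp_all add: card_order_on_def order_on_defs)
  then have "under \<kappa> a \<subseteq> underS \<kappa> b"
    using b by (auto simp: under_def underS_def dest: transD antisymD)
  then have "|under \<kappa> a| \<le>o |underS \<kappa> b|"
    by (rule card_of_mono1)
  then show ?thesis
    using card_of_underS[OF assms(1) b(1)] by (rule ordLeq_ordLess_trans)
qed

text \<open>Otherwise the complements of the fewer than \<open>\<kappa>\<close> points of
  \<open>under \<kappa> a\<close> would all lie in \<open>W\<close>, and so would their
  intersection, which misses \<open>under \<kappa> a\<close>.\<close>

lemma under_in_complete_imp_principal: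
  assumes \<kappa>: "Card_order \<kappa>" "infinite (Field \<kappa>)"
    and W: "ultrafilter_over (Field \<kappa>) W" and comp: "complete_over \<kappa> (Field \<kappa>) W"
    and a: "a \<in> Field \<kappa>" "under \<kappa> a \<in> W"
  shows "\<exists>w\<in>Field \<kappa>. {w} \<in> W"
proof (rule ccontr)
  assume contra: "\<not> (\<exists>w\<in>Field \<kappa>. {w} \<in> W)"
  have sub: "under \<kappa> a \<subseteq> Field \<kappa>"
    by (auto simp: under_def Field_def)
  have "Field \<kappa> - {w} \<in> W" if "w \<in> under \<kappa> a" for w
    using ultrafilter_over_compl[OF W, of "{w}"] sub that contra
    by blast
  from complete_over_INT[OF comp card_of_under_less[OF \<kappa> a(1)] this]
  have "Field \<kappa> \<inter> (\<Inter>w\<in>under \<kappa> a. Field \<kappa> - {w}) \<in> W" .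
  from ultrafilter_over_nonempty[OF W ultrafilter_over_Int[OF W this a(2)]] show False
    by blast
qed

text \<open>As \<open>\<kappa>\<close> is uncountable, the countably many sets witnessing a
  descending chain have a common point, and evaluation there gives a descending chain in
  \<open>\<kappa>\<close>.\<close>

lemma wf_less_mod_ultrafilter:
  assumes \<kappa>: "Card_order \<kappa>" "natLeq <o \<kappa>"
    and W: "ultrafilter_over S W" and comp: "complete_over \<kappa> S W"
  shows "wf {(h, p). {\<beta>\<in>S. (h \<beta>, p \<beta>) \<in> \<kappa> - Id} \<in> W}"
proof -
  have wf: "wf (\<kappa> - Id)"
    using \<kappa>(1) by (simp add: card_order_on_def well_order_on_def)
  have False if s: "\<forall>i. {\<beta>\<in>S. (s (Suc i) \<beta>, s i \<beta>) \<in> \<kappa> - Id} \<in> W" for s :: "nat \<Rightarrow> _ \<Rightarrow> _"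
  proof -
    have "|UNIV :: nat set| <o \<kappa>"
      using card_of_nat \<kappa>(2) by (rule ordIso_ordLess_trans)
    from complete_over_INT[OF comp this s[rule_format]]
    have "S \<inter> (\<Inter>i. {\<beta>\<in>S. (s (Suc i) \<beta>, s i \<beta>) \<in> \<kappa> - Id}) \<in> W" .
    from ultrafilter_over_nonempty[OF W this]
    obtain \<beta> where "\<forall>i. (s (Suc i) \<beta>, s i \<beta>) \<in> \<kappa> - Id"
      by blast
    then have "\<exists>t. \<forall>i. (t (Suc i), t i) \<in> \<kappa> - Id"
      by (rule exI[of _ "\<lambda>i. s i \<beta>"])
    then show False using wf unfolding wf_iff_no_infinite_down_chain by (rule notE[rotated])
  qed
  then show ?thesis unfolding wf_iff_no_infinite_down_chain by blast
qed

text \<open>The order of quantifiers is the point: \<open>T\<close> is fixed before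
  \<open>f\<close>, so all dependence on \<open>f\<close> is carried by the single set
  \<open>G\<close>.\<close>

lemma uniform_diagonal_intersection:
  assumes \<kappa>: "Card_order \<kappa>" "natLeq <o \<kappa>"
    and W: "ultrafilter_over (Field \<kappa>) W" and comp: "complete_over \<kappa> (Field \<kappa>) W"
  obtains T where "\<And>\<alpha>. \<alpha> \<in> Field \<kappa> \<Longrightarrow> T \<alpha> \<in> W"
    and "\<And>f. (\<And>\<alpha>. \<alpha> \<in> Field \<kappa> \<Longrightarrow> f \<alpha> \<in> W) \<Longrightarrow> \<exists>G\<in>W. \<forall>\<alpha>\<in>Field \<kappa>. G \<inter> T \<alpha> \<subseteq> f \<alpha>"
proof -
  let ?S = "Field \<kappa>"
  have inf: "infinite ?S"
    using \<kappa> by (meson Card_order_iff_ordLeq_card_of infinite_iff_natLeq_ordLeq ordLess_imp_ordLeq ordLeq_transitive)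
  have lin: "Linear_order \<kappa>"
    using \<kappa>(1) by (simp add: card_order_on_def well_order_on_def)
  show thesis
  proof (cases "\<exists>w\<in>?S. {w} \<in> W")
    case True
    then obtain w where w: "{w} \<in> W" by blast
    show thesis
    proof (rule that[of "\<lambda>_. ?S"])
      fix f assume f: "\<And>\<alpha>. \<alpha> \<in> ?S \<Longrightarrow> f \<alpha> \<in> W"
      have "w \<in> f \<alpha>" if "\<alpha> \<in> ?S" for \<alpha>
        using ultrafilter_over_nonempty[OF W ultrafilter_over_Int[OF W w f[OF that]]] by blast
      then show "\<exists>G\<in>W. \<forall>\<alpha>\<in>?S. G \<inter> ?S \<subseteq> f \<alpha>" using w by blast
    qed (rule ultrafilter_over_top[OF W])
  next
    case False
    define R where "R = {(h, p). {\<beta>\<in>?S. (h \<beta>, p \<beta>) \<in> \<kappa> - Id} \<in> W}"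
    \<comment> \<open>\<open>T p \<alpha>\<close> is the set on which \<open>p\<close> exceeds
      \<open>\<alpha>\<close>, so \<open>Q\<close> consists of the functions unbounded modulo
      \<open>W\<close>.\<close>
    define T where "T p \<alpha> = {\<beta>\<in>?S. (\<alpha>, p \<beta>) \<in> \<kappa> - Id}" for p :: "'a \<Rightarrow> 'a" and \<alpha>
    define Q where "Q = {p. \<forall>\<alpha>\<in>?S. T p \<alpha> \<in> W}"
    have not_le: "(x, y) \<in> \<kappa> - Id \<longleftrightarrow> (y, x) \<notin> \<kappa>" if "x \<in> ?S" "y \<in> ?S" for x y
      using Linear_order_in_diff_Id[OF lin that(2,1)] by blast
    \<comment> \<open>Nonprincipality puts the identity into \<open>Q\<close>, so a minimal element
      exists.\<close>
    have "T (\<lambda>x. x) \<alpha> \<in> W" if "\<alpha> \<in> ?S" for \<alpha>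
    proof -
      have "under \<kappa> \<alpha> \<notin> W"
        using under_in_complete_imp_principal[OF \<kappa>(1) inf W comp that] False by blast
      then have "?S - under \<kappa> \<alpha> \<in> W"
        by (intro ultrafilter_over_compl[OF W]) (auto simp: under_def Field_def)
      moreover have "?S - under \<kappa> \<alpha> = T (\<lambda>x. x) \<alpha>"
        using not_le[OF that] by (auto simp: T_def under_def)
      ultimately show ?thesis by simp
    qed
    then have id: "(\<lambda>x. x) \<in> Q" by (simp add: Q_def)
    have "wf R"
      unfolding R_def by (rule wf_less_mod_ultrafilter[OF \<kappa> W comp])
    then obtain p where "p \<in> Q" and "\<And>h. (h, p) \<in> R \<Longrightarrow> h \<notin> Q"
      using id by (rule wfE_min) blast
    then have p: "\<And>\<alpha>. \<alpha> \<in> ?S \<Longrightarrow> T p \<alpha> \<in> W"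
      and min: "\<And>h. (h, p) \<in> R \<Longrightarrow> \<exists>\<alpha>\<in>?S. T h \<alpha> \<notin> W"
      by (simp_all add: Q_def)
    show thesis
    proof (rule that[of "T p"])
      fix f assume f: "\<And>\<alpha>. \<alpha> \<in> ?S \<Longrightarrow> f \<alpha> \<in> W"
      define G where "G = {\<beta>\<in>?S. \<forall>\<alpha>. (\<alpha>, p \<beta>) \<in> \<kappa> - Id \<longrightarrow> \<beta> \<in> f \<alpha>}"
      have "G \<in> W"
      proof (rule ccontr)
        assume "G \<notin> W"
        then have GW: "?S - G \<in> W"
          by (intro ultrafilter_over_compl[OF W]) (auto simp: G_def)
        have "\<forall>\<beta>\<in>?S - G. \<exists>\<alpha>. (\<alpha>, p \<beta>) \<in> \<kappa> - Id \<and> \<beta> \<notin> f \<alpha>"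
          by (auto simp: G_def)
        \<comment> \<open>\<open>h\<close> picks an index below \<open>p \<beta>\<close> at which
          the diagonal intersection fails. It is smaller than \<open>p\<close> modulo
          \<open>W\<close>, hence bounded by some \<open>a\<close> modulo \<open>W\<close>.\<close>
        then obtain h where h: "\<And>\<beta>. \<beta> \<in> ?S - G \<Longrightarrow> (h \<beta>, p \<beta>) \<in> \<kappa> - Id"
            "\<And>\<beta>. \<beta> \<in> ?S - G \<Longrightarrow> \<beta> \<notin> f (h \<beta>)"
          by metis
        have "{\<beta>\<in>?S. (h \<beta>, p \<beta>) \<in> \<kappa> - Id} \<in> W"
          by (rule ultrafilter_over_mono[OF W GW]) (use h(1) in auto)
        then obtain a where a: "a \<in> ?S" "T h a \<notin> W"
          using min by (auto simp: R_def)
        have "?S - T h a \<in> W"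
          by (rule ultrafilter_over_compl[OF W _ a(2)]) (auto simp: T_def)
        moreover have "?S \<inter> (\<Inter>\<gamma>\<in>under \<kappa> a. f \<gamma>) \<in> W"
          by (rule complete_over_INT[OF comp card_of_under_less[OF \<kappa>(1) inf a(1)]])
            (use f in \<open>auto simp: under_def Field_def\<close>)
        \<comment> \<open>At a common point \<open>\<beta>\<close> the failing index
          \<open>h \<beta>\<close> is at most \<open>a\<close>, yet \<open>\<beta>\<close> lies in
          \<open>f \<gamma>\<close> for every \<open>\<gamma>\<close> up to
          \<open>a\<close>.\<close>
        ultimately have "(?S - G) \<inter> ((?S - T h a) \<inter> (?S \<inter> (\<Inter>\<gamma>\<in>under \<kappa> a. f \<gamma>))) \<in> W"
          using GW by (simp only: ultrafilter_over_Int[OF W])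
        from ultrafilter_over_nonempty[OF W this]
        obtain \<beta> where \<beta>: "\<beta> \<in> ?S - G" "\<beta> \<notin> T h a" "\<And>\<gamma>. \<gamma> \<in> under \<kappa> a \<Longrightarrow> \<beta> \<in> f \<gamma>"
          by blast
        have "h \<beta> \<in> ?S" using h(1)[OF \<beta>(1)] by (auto simp: Field_def)
        then have "h \<beta> \<in> under \<kappa> a"
          using not_le[OF a(1)] \<beta>(1,2) by (auto simp: T_def under_def)
        then show False using \<beta>(3) h(2)[OF \<beta>(1)] by blast
      qed
      moreover have "\<forall>\<alpha>\<in>?S. G \<inter> T p \<alpha> \<subseteq> f \<alpha>" by (auto simp: G_def T_def)
      ultimately show "\<exists>G\<in>W. \<forall>\<alpha>\<in>?S. G \<inter> T p \<alpha> \<subseteq> f \<alpha>" by blast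
    qed (rule p)
  qed
qed

section \<open>Thinning out families in the Fubini product\<close>

theorem mainTheorem4:
  fixes \<kappa> :: "'k rel" and lam :: "'l rel" and \<mu> :: "'m rel"
    and U W :: "'k set set"
  assumes "Card_order \<kappa>" and "natLeq <o \<kappa>"
    and "ultrafilter_over (Field \<kappa>) U" and "complete_over \<kappa> (Field \<kappa>) U"
    and "ultrafilter_over (Field \<kappa>) W" and "complete_over \<kappa> (Field \<kappa>) W"
    and "Card_order lam" and "Card_order \<mu>" and "\<mu> \<le>o lam"
    and "(cohesive lam lam (Field \<kappa>) U \<and> cohesive lam \<mu> (Field \<kappa>) W) \<or>
         (cohesive lam lam (Field \<kappa>) W \<and> cohesive lam \<mu> (Field \<kappa>) U)"
  shows "cohesive lam \<mu> (Field \<kappa> \<times> Field \<kappa>) (Fubini_product (Field \<kappa>) (Field \<kappa>) U W)"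
proof -
  let ?S = "Field \<kappa>"
  note U = assms(3) and W = assms(5)
  have inf: "infinite ?S"
    using assms(1,2) by (meson Card_order_iff_ordLeq_card_of infinite_iff_natLeq_ordLeq ordLess_imp_ordLeq ordLeq_transitive)
  obtain T where T: "\<And>\<alpha>. \<alpha> \<in> ?S \<Longrightarrow> T \<alpha> \<in> W"
    and diag: "\<And>f. (\<And>\<alpha>. \<alpha> \<in> ?S \<Longrightarrow> f \<alpha> \<in> W) \<Longrightarrow> \<exists>G\<in>W. \<forall>\<alpha>\<in>?S. G \<inter> T \<alpha> \<subseteq> f \<alpha>"
    using uniform_diagonal_intersection[OF assms(1,2,5,6)] by metis
  define sec where "sec X \<alpha> = {\<beta>\<in>?S. (\<alpha>, \<beta>) \<in> X}" for X :: "('k \<times> 'k) set" and \<alpha>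
  define big where "big X = {\<alpha>\<in>?S. sec X \<alpha> \<in> W}" for X
  have F: "X \<in> Fubini_product ?S ?S U W \<longleftrightarrow> X \<subseteq> ?S \<times> ?S \<and> big X \<in> U" for X
    by (simp add: Fubini_product_def big_def sec_def)
  \<comment> \<open>The default \<open>?S\<close> off \<open>big X\<close> makes the family of
    sections total, as \<open>diag\<close> requires.\<close>
  have "\<exists>G\<in>W. \<forall>\<alpha>\<in>?S. G \<inter> T \<alpha> \<subseteq> (if \<alpha> \<in> big X then sec X \<alpha> else ?S)" for X
    by (rule diag) (auto simp: big_def ultrafilter_over_top[OF W])
  then obtain G where G: "\<And>X. G X \<in> W"
    and G_if: "\<And>X. \<forall>\<alpha>\<in>?S. G X \<inter> T \<alpha> \<subseteq> (if \<alpha> \<in> big X then sec X \<alpha> else ?S)"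
    by metis
  have G_sec: "G X \<inter> T \<alpha> \<subseteq> sec X \<alpha>" if "\<alpha> \<in> big X" for X \<alpha>
  proof -
    have "\<alpha> \<in> ?S" using that by (simp add: big_def)
    with G_if[of X] that show ?thesis by (metis (full_types))
  qed
  \<comment> \<open>Since \<open>T \<alpha>\<close> does not depend on \<open>X\<close>, one
    intersection with it handles all sections at \<open>\<alpha>\<close>, however large
    \<open>\<B>\<close> is.\<close>
  have combine: "?S \<times> ?S \<inter> \<Inter>\<B> \<in> Fubini_product ?S ?S U W"
    if A: "?S \<inter> (\<Inter>X\<in>\<B>. big X) \<in> U" and B: "?S \<inter> (\<Inter>X\<in>\<B>. G X) \<in> W" for \<B>
  proof -
    have "?S \<inter> (\<Inter>X\<in>\<B>. big X) \<subseteq> big (?S \<times> ?S \<inter> \<Inter>\<B>)"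
    proof
      fix \<alpha> assume \<alpha>: "\<alpha> \<in> ?S \<inter> (\<Inter>X\<in>\<B>. big X)"
      have "(?S \<inter> (\<Inter>X\<in>\<B>. G X)) \<inter> T \<alpha> \<in> W"
        using ultrafilter_over_Int[OF W B T] \<alpha> by blast
      moreover have "(?S \<inter> (\<Inter>X\<in>\<B>. G X)) \<inter> T \<alpha> \<subseteq> sec (?S \<times> ?S \<inter> \<Inter>\<B>) \<alpha>"
        using G_sec \<alpha> by (fastforce simp: sec_def)
      moreover have "sec (?S \<times> ?S \<inter> \<Inter>\<B>) \<alpha> \<subseteq> ?S" by (auto simp: sec_def)
      ultimately have "sec (?S \<times> ?S \<inter> \<Inter>\<B>) \<alpha> \<in> W"
        by (rule ultrafilter_over_mono[OF W])
      then show "\<alpha> \<in> big (?S \<times> ?S \<inter> \<Inter>\<B>)" using \<alpha> by (simp add: big_def)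
    qed
    then have "big (?S \<times> ?S \<inter> \<Inter>\<B>) \<in> U"
      by (rule ultrafilter_over_mono[OF U A]) (auto simp: big_def)
    then show ?thesis by (simp add: F)
  qed
  \<comment> \<open>An injection of pairs into \<open>?S\<close> bounds the size of
    \<open>\<A>\<close> by \<open>|Pow ?S|\<close>, as \<open>cohesive_indexed\<close>
    needs.\<close>
  obtain k where "inj_on k (?S \<times> ?S)" "k ` (?S \<times> ?S) \<subseteq> ?S"
    using card_of_ordLeq[of "?S \<times> ?S" ?S] ordIso_imp_ordLeq[OF card_of_Times_same_infinite[OF inf]]
    by blast
  then have "inj_on ((`) k) (Pow (?S \<times> ?S))" "(`) k ` Pow (?S \<times> ?S) \<subseteq> Pow ?S"
    by (auto intro: inj_on_image_Pow)
  then have PowS: "|Pow (?S \<times> ?S)| \<le>o |Pow ?S|"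
    using card_of_ordLeq by blast
  show ?thesis
    unfolding cohesive_def
  proof (intro allI impI)
    fix \<A> assume "\<A> \<subseteq> Fubini_product ?S ?S U W \<and> |\<A>| =o lam"
    then have \<A>: "\<A> \<subseteq> Fubini_product ?S ?S U W" "|\<A>| =o lam" by auto
    have le: "|\<B>| \<le>o |Pow ?S|" if "\<B> \<subseteq> \<A>" for \<B>
    proof -
      have "\<B> \<subseteq> Pow (?S \<times> ?S)" using that \<A>(1) F by auto
      then show ?thesis using card_of_mono1 PowS ordLeq_transitive by blast
    qed
    have big: "big X \<in> U" if "X \<in> \<A>" for X using \<A>(1) F that by blast
    have "\<exists>\<B>\<subseteq>\<A>. |\<B>| =o \<mu> \<and> ?S \<inter> (\<Inter>X\<in>\<B>. big X) \<in> U \<and> ?S \<inter> (\<Inter>X\<in>\<B>. G X) \<in> W"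
      using assms(10)
    proof
      assume c: "cohesive lam lam ?S U \<and> cohesive lam \<mu> ?S W"
      obtain \<C> where C: "\<C> \<subseteq> \<A>" "|\<C>| =o lam" "?S \<inter> (\<Inter>X\<in>\<C>. big X) \<in> U"
        using cohesive_indexed[OF inf U conjunct1[OF c] \<A>(2) le[OF subset_refl], of big] big by blast
      obtain \<B> where B: "\<B> \<subseteq> \<C>" "|\<B>| =o \<mu>" "?S \<inter> (\<Inter>X\<in>\<B>. G X) \<in> W"
        using cohesive_indexed[OF inf W conjunct2[OF c] C(2) le[OF C(1)], of G] G by blast
      \<comment> \<open>The first thinning survives the second: a subfamily has a larger
        intersection.\<close>
      have "?S \<inter> (\<Inter>X\<in>\<B>. big X) \<in> U"
        by (rule ultrafilter_over_mono[OF U C(3)]) (use B(1) in auto)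
      then show ?thesis using B C(1) by blast
    next
      assume c: "cohesive lam lam ?S W \<and> cohesive lam \<mu> ?S U"
      obtain \<C> where C: "\<C> \<subseteq> \<A>" "|\<C>| =o lam" "?S \<inter> (\<Inter>X\<in>\<C>. G X) \<in> W"
        using cohesive_indexed[OF inf W conjunct1[OF c] \<A>(2) le[OF subset_refl], of G] G by blast
      obtain \<B> where B: "\<B> \<subseteq> \<C>" "|\<B>| =o \<mu>" "?S \<inter> (\<Inter>X\<in>\<B>. big X) \<in> U"
        using cohesive_indexed[OF inf U conjunct2[OF c] C(2) le[OF C(1)], of big] big C(1) by blast
      have "?S \<inter> (\<Inter>X\<in>\<B>. G X) \<in> W"
        by (rule ultrafilter_over_mono[OF W C(3)]) (use B(1) in auto)
      then show ?thesis using B C(1) by blast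
    qed
    then show "\<exists>\<B>\<subseteq>\<A>. |\<B>| =o \<mu> \<and> ?S \<times> ?S \<inter> \<Inter>\<B> \<in> Fubini_product ?S ?S U W"
      using combine by blast
  qed
qed

end
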